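(* Let $\mathcal{A}$ be a formal (central) hyperplane arrangement in a finite-dimensional vector space $V$ over a field $\mathbb{K}$. Then for every $Z\in L(\mathcal{A})$, the restriction $\mathcal{A}^Z$ (an arrangement in $Z$) is formal. In other words, formality is hereditary.
   Context: A hyperplane arrangement $\mathcal{A}$ in $V$ is a finite set of linear hyperplanes. $L(\mathcal{A})$ is the set of all intersections of subsets of $\mathcal{A}$ (including $V$). For $Z\in L(\mathcal{A})$, the localization is $\mathcal{A}_Z=\{H\in\mathcal{A}: Z\subseteq H\}$ and the restriction is the arrangement $\mathcal{A}^Z=\{Z\cap H: H\in\mathcal{A}\setminus\mathcal{A}_Z\}$ of hyperplanes in the vector space $Z$. Formality: choose $\alpha_H\in V^*$ with $\ker\alpha_H=H$ for each $H\in\mathcal{A}$, and let $F(\mathcal{A})$ be the kernel of the linear map $\bigoplus_{H\in\mathcal{A}}\mathbb{K}e_H\to V^*$, $e_H\mapsto\alpha_H$. An element of $F(\mathcal{A})$ has length $p$ if it has exactly $p$ nonzero coordinates. $\mathcal{A}$ is formal if $F(\mathcal{A})$ is spanned by its elements of length at most $3$ (equivalently, by the dependencies among hyperplanes containing a common codimension-$2$ intersection). *)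

theory Defs
  imports Complex_Main "HOL-Library.Function_Algebras"
begin

text \<open>
  Restrictions of an arrangement live in subspaces of the ambient space, so every notion below is
  relative to a carrier subspace \<open>V\<close> of a vector space whose elements form the type \<open>'b\<close>.
  The argument \<open>scale\<close> is its scalar multiplication.
\<close>

text \<open>
  For finite-dimensional \<open>V\<close> only: the library's dimension is \<open>0\<close> on infinite-dimensional spaces.
\<close>

definition hyperplane_in ::
    "('a::field \<Rightarrow> 'b::ab_group_add \<Rightarrow> 'b) \<Rightarrow> 'b set \<Rightarrow> 'b set \<Rightarrow> bool" where
  "hyperplane_in scale V H \<longleftrightarrow>
     module.subspace scale H \<and> H \<subseteq> V \<and>
     vector_space.dim scale V = vector_space.dim scale H + 1"

definition hyperplane_arrangement ::
    "('a::field \<Rightarrow> 'b::ab_group_add \<Rightarrow> 'b) \<Rightarrow> 'b set \<Rightarrow> 'b set set \<Rightarrow> bool" where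
  "hyperplane_arrangement scale V A \<longleftrightarrow> finite A \<and> (\<forall>H\<in>A. hyperplane_in scale V H)"

text \<open>The intersection over the empty family is \<open>V\<close>, not \<^const>\<open>UNIV\<close>.\<close>

definition intersections :: "'b set \<Rightarrow> 'b set set \<Rightarrow> 'b set set" where
  "intersections V A = {V \<inter> \<Inter>B | B. B \<subseteq> A}"

definition localization :: "'b set set \<Rightarrow> 'b set \<Rightarrow> 'b set set" where
  "localization A Z = {H \<in> A. Z \<subseteq> H}"

definition restriction :: "'b set set \<Rightarrow> 'b set \<Rightarrow> 'b set set" where
  "restriction A Z = {Z \<inter> H | H. H \<in> A - localization A Z}"

text \<open>
  An element of the dual of \<open>V\<close> is represented by a function on the whole type, of which only the
  values on \<open>V\<close> matter.
\<close>

definition linear_form_on ::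
    "('a::field \<Rightarrow> 'b::ab_group_add \<Rightarrow> 'b) \<Rightarrow> 'b set \<Rightarrow> ('b \<Rightarrow> 'a) \<Rightarrow> bool" where
  "linear_form_on scale V f \<longleftrightarrow>
     (\<forall>x\<in>V. \<forall>y\<in>V. f (x + y) = f x + f y) \<and> (\<forall>r. \<forall>x\<in>V. f (scale r x) = r * f x)"

definition defining_forms ::
    "('a::field \<Rightarrow> 'b::ab_group_add \<Rightarrow> 'b) \<Rightarrow> 'b set \<Rightarrow> 'b set set \<Rightarrow>
     ('b set \<Rightarrow> 'b \<Rightarrow> 'a) \<Rightarrow> bool" where
  "defining_forms scale V A \<alpha> \<longleftrightarrow>
     (\<forall>H\<in>A. linear_form_on scale V (\<alpha> H) \<and> {v \<in> V. \<alpha> H v = 0} = H)"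

text \<open>
  The kernel of \<open>e\<^sub>H \<mapsto> \<alpha>\<^sub>H\<close>. A vector of the direct sum over \<open>A\<close> is its coordinate function,
  extended by \<open>0\<close> outside \<open>A\<close>.
\<close>

definition dependencies ::
    "'b set \<Rightarrow> 'b set set \<Rightarrow> ('b set \<Rightarrow> 'b \<Rightarrow> 'a::field) \<Rightarrow> ('b set \<Rightarrow> 'a) set" where
  "dependencies V A \<alpha> =
     {c. (\<forall>H. H \<notin> A \<longrightarrow> c H = 0) \<and> (\<forall>v\<in>V. (\<Sum>H\<in>A. c H * \<alpha> H v) = 0)}"

definition dep_length :: "'b set set \<Rightarrow> ('b set \<Rightarrow> 'a::zero) \<Rightarrow> nat" where
  "dep_length A c = card {H \<in> A. c H \<noteq> 0}"

definition spanned_by_short ::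
    "'b set \<Rightarrow> 'b set set \<Rightarrow> ('b set \<Rightarrow> 'b \<Rightarrow> 'a::field) \<Rightarrow> bool" where
  "spanned_by_short V A \<alpha> \<longleftrightarrow>
     module.span (\<lambda>r c H. r * c H) {c \<in> dependencies V A \<alpha>. dep_length A c \<le> 3}
       = dependencies V A \<alpha>"

text \<open>The choice of defining forms is immaterial, see \<open>formal_iff\<close> below.\<close>

definition formal ::
    "('a::field \<Rightarrow> 'b::ab_group_add \<Rightarrow> 'b) \<Rightarrow> 'b set \<Rightarrow> 'b set set \<Rightarrow> bool" where
  "formal scale V A \<longleftrightarrow> (\<exists>\<alpha>. defining_forms scale V A \<alpha> \<and> spanned_by_short V A \<alpha>)"

context vector_space
begin

lemma forms_proportional:
  assumes V: "module.subspace scale V"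
    and f: "linear_form_on scale V f" and g: "linear_form_on scale V g"
    and ker: "{v \<in> V. f v = 0} = {v \<in> V. g v = 0}"
  shows "\<exists>t. t \<noteq> 0 \<and> (\<forall>v\<in>V. g v = t * f v)"
proof (cases "\<forall>v\<in>V. f v = 0")
  case True
  then have "\<forall>v\<in>V. g v = 0" using ker by blast
  with True show ?thesis by (intro exI[of _ 1]) auto
next
  case False
  then obtain u where u: "u \<in> V" "f u \<noteq> 0" by blast
  then have gu: "g u \<noteq> 0" using ker by blast
  have "g v = (g u / f u) * f v" if v: "v \<in> V" for v
  proof -
    define r where "r = - (f v / f u)"
    have m: "scale r u \<in> V" using subspace_scale[OF V u(1)] .
    have w: "v + scale r u \<in> V" using subspace_add[OF V v m] .
    have lin: "h (v + scale r u) = h v + r * h u" if "linear_form_on scale V h" for h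
      using that v m u(1) by (simp add: linear_form_on_def)
    have "f (v + scale r u) = 0" unfolding lin[OF f] using u(2) by (simp add: r_def)
    then have "g (v + scale r u) = 0" using ker w by blast
    then have "g v + r * g u = 0" unfolding lin[OF g] .
    then have "g v = - (r * g u)" by (rule eq_neg_iff_add_eq_0[THEN iffD2])
    also have "\<dots> = (g u / f u) * f v" by (simp add: r_def)
    finally show ?thesis .
  qed
  moreover have "g u / f u \<noteq> 0" using u gu by simp
  ultimately show ?thesis by blast
qed

lemma spanned_by_short_transfer:
  assumes V: "module.subspace scale V"
    and a: "defining_forms scale V A \<alpha>" and b: "defining_forms scale V A \<beta>"
    and gen: "spanned_by_short V A \<alpha>"
  shows "spanned_by_short V A \<beta>"
proof -
  define fscale where "fscale = (\<lambda>(r::'a) (c::'b set \<Rightarrow> 'a) H. r * c H)"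
  interpret fs: module fscale
    by unfold_locales (simp_all add: fscale_def fun_eq_iff algebra_simps)
  have "\<forall>H\<in>A. \<exists>t. t \<noteq> 0 \<and> (\<forall>v\<in>V. \<beta> H v = t * \<alpha> H v)"
    using a b unfolding defining_forms_def by (intro ballI forms_proportional[OF V]) simp_all
  then obtain t where t: "\<forall>H\<in>A. t H \<noteq> 0 \<and> (\<forall>v\<in>V. \<beta> H v = t H * \<alpha> H v)"
    by (rule bchoice[THEN exE])
  define s where "s H = (if H \<in> A then t H else 1)" for H
  have s: "s H \<noteq> 0" for H using t by (simp add: s_def)
  define \<phi> where "\<phi> c H = c H / s H" for c :: "'b set \<Rightarrow> 'a" and H
  interpret ph: module_hom fscale fscale \<phi>
    by unfold_locales (simp_all add: fscale_def fun_eq_iff \<phi>_def add_divide_distrib)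
  have len: "dep_length A (\<phi> c) = dep_length A c" for c
    by (simp add: dep_length_def \<phi>_def s)
  have mem: "\<phi> c \<in> dependencies V A \<beta> \<longleftrightarrow> c \<in> dependencies V A \<alpha>" for c
  proof -
    have "(\<Sum>H\<in>A. \<phi> c H * \<beta> H v) = (\<Sum>H\<in>A. c H * \<alpha> H v)" if "v \<in> V" for v
      using t that by (intro sum.cong) (simp_all add: \<phi>_def s_def)
    then show ?thesis by (simp add: dependencies_def \<phi>_def s)
  qed
  have surj: "c = \<phi> (\<lambda>H. c H * s H)" for c
    by (simp add: \<phi>_def fun_eq_iff s)
  have im: "\<phi> ` {c. P (\<phi> c)} = {c. P c}" for P
  proof (intro equalityI subsetI)
    fix c assume "c \<in> {c. P c}"
    then show "c \<in> \<phi> ` {c. P (\<phi> c)}"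
      using surj[of c] by (intro image_eqI[where x = "\<lambda>H. c H * s H"]) simp_all
  qed blast
  have im1: "\<phi> ` dependencies V A \<alpha> = dependencies V A \<beta>"
    using im[of "\<lambda>c. c \<in> dependencies V A \<beta>"] by (simp add: mem)
  have im3: "\<phi> ` {c \<in> dependencies V A \<alpha>. dep_length A c \<le> 3}
      = {c \<in> dependencies V A \<beta>. dep_length A c \<le> 3}"
    using im[of "\<lambda>c. c \<in> dependencies V A \<beta> \<and> dep_length A c \<le> 3"] by (simp add: mem len)
  show ?thesis
    using gen ph.span_image[of "{c \<in> dependencies V A \<alpha>. dep_length A c \<le> 3}"]
    by (simp add: spanned_by_short_def im1 im3 flip: fscale_def)
qed

lemma formal_iff:
  assumes "module.subspace scale V" and "defining_forms scale V A \<alpha>"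
  shows "formal scale V A \<longleftrightarrow> spanned_by_short V A \<alpha>"
  using assms spanned_by_short_transfer unfolding formal_def by blast

end

end

theory Submission
  imports Defs
begin

text \<open>
  Represent every \<open>X \<in> A\<^sup>Z\<close> as \<open>X = Z \<inter> r X\<close> with \<open>r X \<in> A - A\<^sub>Z\<close>, and take
  \<open>\<alpha> (r X)\<close>, restricted to \<open>Z\<close>, as its defining form. For \<open>H \<in> A - A\<^sub>Z\<close> the form \<open>\<alpha> H\<close> is on \<open>Z\<close>
  a multiple \<open>t H\<close> of the chosen form of \<open>Z \<inter> H\<close>. The linear map \<open>\<pi>\<close> sending \<open>e\<^sub>H\<close> to \<open>0\<close> if
  \<open>Z \<subseteq> H\<close>, and to \<open>t H \<cdot> e\<^bsub>Z \<inter> H\<^esub>\<close> otherwise, maps dependencies of \<open>A\<close> to dependencies of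
  \<open>A\<^sup>Z\<close> and does not increase length. It is onto: if \<open>\<Sum>\<^sub>X c X \<cdot> \<alpha> (r X)\<close> vanishes on \<open>Z\<close>, then it is
  a linear combination of the forms that define \<open>Z\<close>, which is a dependency of \<open>A\<close> lying over \<open>c\<close>.
  Hence generation by short dependencies passes from \<open>A\<close> to \<open>A\<^sup>Z\<close>.
\<close>

context vector_space
begin

lemma linear_form_on_subset:
  "linear_form_on scale V f \<Longrightarrow> W \<subseteq> V \<Longrightarrow> linear_form_on scale W f"
  unfolding linear_form_on_def by blast

lemma linear_form_on_zero:
  assumes "linear_form_on scale V f" "x \<in> V"
  shows "f 0 = 0"
proof -
  have "f (scale 0 x) = 0 * f x" using assms unfolding linear_form_on_def by blast
  then show ?thesis by simp
qed

lemma linear_form_on_sum: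
  assumes "\<And>i. i \<in> S \<Longrightarrow> linear_form_on scale V (g i)"
  shows "linear_form_on scale V (\<lambda>v. \<Sum>i\<in>S. c i * g i v)"
proof -
  have "(\<Sum>i\<in>S. c i * g i (x + y)) = (\<Sum>i\<in>S. c i * g i x) + (\<Sum>i\<in>S. c i * g i y)"
    if "x \<in> V" "y \<in> V" for x y
    using assms that
    by (subst sum.distrib[symmetric], intro sum.cong) (auto simp: linear_form_on_def algebra_simps)
  moreover have "(\<Sum>i\<in>S. c i * g i (scale r x)) = r * (\<Sum>i\<in>S. c i * g i x)" if "x \<in> V" for r x
    using assms that
    by (subst sum_distrib_left, intro sum.cong) (auto simp: linear_form_on_def algebra_simps)
  ultimately show ?thesis unfolding linear_form_on_def by blast
qed

lemma linear_form_on_diff: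
  assumes "linear_form_on scale V f" "linear_form_on scale V g"
  shows "linear_form_on scale V (\<lambda>v. f v - g v)"
  using assms unfolding linear_form_on_def by (simp add: algebra_simps)

lemma subspace_kernel:
  assumes V: "subspace V" and f: "linear_form_on scale V f"
  shows "subspace {v \<in> V. f v = 0}"
proof (rule subspaceI)
  show "0 \<in> {v \<in> V. f v = 0}"
    using subspace_0[OF V] linear_form_on_zero[OF f] by blast
next
  fix x y assume "x \<in> {v \<in> V. f v = 0}" "y \<in> {v \<in> V. f v = 0}"
  then show "x + y \<in> {v \<in> V. f v = 0}"
    using f subspace_add[OF V] by (simp add: linear_form_on_def)
next
  fix r x assume "x \<in> {v \<in> V. f v = 0}"
  then show "scale r x \<in> {v \<in> V. f v = 0}"
    using f subspace_scale[OF V] by (simp add: linear_form_on_def)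
qed

text \<open>The correction term is the multiple of \<open>u\<close> on which \<open>g\<close> takes
  the value \<open>- g v\<close>. So \<open>V\<close> is the kernel plus the line through
  \<open>u\<close>.\<close>

lemma kernel_decomposition:
  assumes V: "subspace V" and g: "linear_form_on scale V g"
    and u: "u \<in> V" "g u \<noteq> 0" and v: "v \<in> V"
  shows "v + scale (- (g v / g u)) u \<in> {v \<in> V. g v = 0}"
proof -
  define r where "r = - (g v / g u)"
  have m: "scale r u \<in> V" using subspace_scale[OF V u(1)] .
  have "g (v + scale r u) = g v + r * g u"
    using g u(1) v m by (simp add: linear_form_on_def)
  then have "v + scale r u \<in> {v \<in> V. g v = 0}"
    using subspace_add[OF V v m] u(2) by (simp add: r_def)
  then show ?thesis by (simp only: r_def)
qed

text \<open>By \<open>kernel_decomposition\<close>, every \<open>v\<close> is a multiple of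
  \<open>u\<close> modulo the kernel of \<open>g\<close>, where \<open>f\<close> vanishes too, so
  \<open>f\<close> is determined by its value at \<open>u\<close>. Here \<open>t\<close> may be
  0.\<close>

lemma form_multiple_of_kernel_subset:
  assumes V: "subspace V"
    and g: "linear_form_on scale V g" and f: "linear_form_on scale V f"
    and ker: "\<And>v. v \<in> V \<Longrightarrow> g v = 0 \<Longrightarrow> f v = 0"
  shows "\<exists>t. \<forall>v\<in>V. f v = t * g v"
proof (cases "\<forall>v\<in>V. g v = 0")
  case True
  then show ?thesis using ker by auto
next
  case False
  then obtain u where u: "u \<in> V" "g u \<noteq> 0" by blast
  have "f v = (f u / g u) * g v" if v: "v \<in> V" for v
  proof -
    define r where "r = - (g v / g u)"
    have "f (v + scale r u) = 0"
      using kernel_decomposition[OF V g u v] ker unfolding r_def by blast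
    moreover have "f (v + scale r u) = f v + r * f u"
      using f u v subspace_scale[OF V u(1)] by (simp add: linear_form_on_def)
    ultimately have "f v = - (r * f u)" by (simp add: eq_neg_iff_add_eq_0)
    then show ?thesis by (simp add: r_def)
  qed
  then show ?thesis by blast
qed

text \<open>Induction on \<open>S\<close>: on the kernel \<open>W\<close> of one form, the others
  already express \<open>f\<close>. The difference then vanishes on \<open>W\<close>, so it is a
  multiple of that form. \<open>V\<close> must vary because the induction hypothesis is applied to
  \<open>W\<close>.\<close>

lemma form_vanishing_on_common_kernel:
  assumes "finite S" and "subspace V"
    and "\<And>i. i \<in> S \<Longrightarrow> linear_form_on scale V (g i)" and "linear_form_on scale V f"
    and "\<And>v. v \<in> V \<Longrightarrow> (\<And>i. i \<in> S \<Longrightarrow> g i v = 0) \<Longrightarrow> f v = 0"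
  shows "\<exists>c. \<forall>v\<in>V. f v = (\<Sum>i\<in>S. c i * g i v)"
  using assms
proof (induction S arbitrary: V rule: finite_induct)
  case empty
  then show ?case by simp
next
  case (insert i S)
  define W where "W = {v \<in> V. g i v = 0}"
  have WV: "W \<subseteq> V" by (auto simp: W_def)
  have "\<exists>c. \<forall>v\<in>W. f v = (\<Sum>j\<in>S. c j * g j v)"
  proof (rule insert.IH)
    show "subspace W" unfolding W_def using insert.prems by (intro subspace_kernel) auto
    show "linear_form_on scale W (g j)" if "j \<in> S" for j
      using insert.prems that WV by (blast intro: linear_form_on_subset)
    show "linear_form_on scale W f"
      using insert.prems WV by (blast intro: linear_form_on_subset)
    show "f v = 0" if "v \<in> W" "\<And>j. j \<in> S \<Longrightarrow> g j v = 0" for v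
      using insert.prems(4)[of v] that by (auto simp: W_def)
  qed
  then obtain c where c: "\<forall>v\<in>W. f v = (\<Sum>j\<in>S. c j * g j v)" by blast
  have "\<exists>t. \<forall>v\<in>V. f v - (\<Sum>j\<in>S. c j * g j v) = t * g i v"
    using insert.prems c
    by (intro form_multiple_of_kernel_subset linear_form_on_diff linear_form_on_sum)
      (auto simp: W_def)
  then obtain t where t: "\<forall>v\<in>V. f v - (\<Sum>j\<in>S. c j * g j v) = t * g i v" by blast
  have "f v = (\<Sum>j\<in>insert i S. (c(i := t)) j * g j v)" if "v \<in> V" for v
  proof -
    have "(\<Sum>j\<in>S. (c(i := t)) j * g j v) = (\<Sum>j\<in>S. c j * g j v)"
      using insert.hyps by (intro sum.cong) auto
    then show ?thesis using t that insert.hyps by (simp add: algebra_simps)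
  qed
  then show ?case by blast
qed

section \<open>Kernels of nonzero forms as hyperplanes\<close>

lemma hyperplane_in_kernel:
  assumes V: "subspace V" and fin: "finite B" "V \<subseteq> span B"
    and f: "linear_form_on scale V f" and u: "u \<in> V" "f u \<noteq> 0"
  shows "hyperplane_in scale V {v \<in> V. f v = 0}"
proof -
  let ?K = "{v \<in> V. f v = 0}"
  have K: "subspace ?K" using subspace_kernel[OF V f] .
  obtain b where b: "b \<subseteq> ?K" "independent b" "?K \<subseteq> span b" "card b = dim ?K"
    using basis_exists[of ?K] by blast
  \<comment> \<open>Adding \<open>u\<close> to \<open>b\<close> will give a basis of
    \<open>V\<close>. Finiteness makes its cardinality exactly one larger, since \<open>card\<close>
    is 0 on infinite sets.\<close>
  have finb: "finite b"
    using independent_span_bound[OF fin(1) b(2)] b(1) fin(2) by blast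
  have spb: "span b = ?K" using b(1,3) K by (metis span_subspace)
  have un: "u \<notin> span b" using u spb by simp
  have ind: "independent (insert u b)" using un b(2) by (simp add: independent_insert)
  have sub: "insert u b \<subseteq> V" using u b(1) by blast
  have sp: "V \<subseteq> span (insert u b)"
  proof
    fix v assume v: "v \<in> V"
    have "v + scale (- (f v / f u)) u \<in> span b"
      using kernel_decomposition[OF V f u v] spb by simp
    then have "v - scale (f v / f u) u \<in> span b" by simp
    then show "v \<in> span (insert u b)" using span_breakdown_eq by blast
  qed
  have "u \<notin> b" using un span_base by blast
  then have "dim V = dim ?K + 1"
    using dim_unique[OF sub sp ind refl] finb b(4) by simp
  then show ?thesis using K unfolding hyperplane_in_def by blast
qed

section \<open>Projecting dependencies to the restriction\<close>

lemma spanned_by_short_restriction: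
  assumes V: "subspace V" and fin: "finite A"
    and \<alpha>: "defining_forms scale V A \<alpha>" and gen: "spanned_by_short V A \<alpha>"
    and Z: "Z \<in> intersections V A" "subspace Z"
    and r: "\<And>X. X \<in> restriction A Z \<Longrightarrow> r X \<in> A - localization A Z \<and> Z \<inter> r X = X"
  shows "spanned_by_short Z (restriction A Z) (\<lambda>X. \<alpha> (r X))"
proof -
  define L where "L = localization A Z"
  define R where "R = restriction A Z"
  have R: "R = (\<inter>) Z ` (A - L)" unfolding R_def L_def restriction_def by blast
  have LA: "L \<subseteq> A" unfolding L_def localization_def by blast
  have finR: "finite R" and finL: "finite L" using fin R LA by (auto intro: finite_subset)
  have ZV: "Z \<subseteq> V" using Z(1) unfolding intersections_def by blast
  have lin: "linear_form_on scale V (\<alpha> H)" if "H \<in> A" for H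
    using \<alpha> that unfolding defining_forms_def by blast
  have linZ: "linear_form_on scale Z (\<alpha> H)" if "H \<in> A" for H
    using linear_form_on_subset[OF lin[OF that] ZV] .
  have ker: "\<alpha> H v = 0 \<longleftrightarrow> v \<in> H" if "H \<in> A" "v \<in> V" for H v
    using \<alpha> that unfolding defining_forms_def by blast
  have rX: "r X \<in> A" "r X \<notin> L" "Z \<inter> r X = X" if "X \<in> R" for X
    using r that unfolding R_def L_def by auto
  have ZH: "Z \<inter> H \<in> R" if "H \<in> A - L" for H using that unfolding R by blast

  \<comment> \<open>Both forms have kernel \<open>Z \<inter> H\<close> on \<open>Z\<close>.\<close>
  have "\<forall>H\<in>A - L. \<exists>t. \<forall>v\<in>Z. \<alpha> H v = t * \<alpha> (r (Z \<inter> H)) v"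
  proof
    fix H assume H: "H \<in> A - L"
    show "\<exists>t. \<forall>v\<in>Z. \<alpha> H v = t * \<alpha> (r (Z \<inter> H)) v"
    proof (rule form_multiple_of_kernel_subset[OF Z(2) linZ linZ])
      show "r (Z \<inter> H) \<in> A" "H \<in> A" using rX ZH H by blast+
      fix v assume v: "v \<in> Z" "\<alpha> (r (Z \<inter> H)) v = 0"
      then have "v \<in> Z \<inter> r (Z \<inter> H)" using ker rX(1)[OF ZH[OF H]] ZV by blast
      then show "\<alpha> H v = 0" using rX(3)[OF ZH[OF H]] ker H ZV by blast
    qed
  qed
  then obtain t where t: "\<forall>H\<in>A - L. \<forall>v\<in>Z. \<alpha> H v = t H * \<alpha> (r (Z \<inter> H)) v"
    by (rule bchoice[THEN exE])
  \<comment> \<open>\<open>r X\<close> represents its own trace on \<open>Z\<close>, and its form is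
    nonzero somewhere on \<open>Z\<close>, which forces the factor to be 1.\<close>
  have tr: "t (r X) = 1" if X: "X \<in> R" for X
  proof -
    have "\<not> Z \<subseteq> r X" using rX[OF X] unfolding L_def localization_def by blast
    then obtain v where v: "v \<in> Z" "v \<notin> r X" by blast
    have "\<alpha> (r X) v \<noteq> 0" using v ker rX[OF X] ZV by blast
    moreover have "\<alpha> (r X) v = t (r X) * \<alpha> (r (Z \<inter> r X)) v"
      using t rX(1,2)[OF X] v(1) by blast
    ultimately show ?thesis unfolding rX(3)[OF X] by (metis mult_cancel_right1)
  qed

  define fscale where "fscale = (\<lambda>(r::'a) (c::'b set \<Rightarrow> 'a) H. r * c H)"
  interpret fs: module fscale
    by unfold_locales (simp_all add: fscale_def fun_eq_iff algebra_simps)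
  \<comment> \<open>Several hyperplanes may have the same trace \<open>X\<close> on
    \<open>Z\<close>; their rescaled coefficients add up.\<close>
  define \<pi> where
    "\<pi> d X = (if X \<in> R then \<Sum>H | H \<in> A - L \<and> Z \<inter> H = X. t H * d H else 0)"
    for d :: "'b set \<Rightarrow> 'a" and X
  interpret p: module_hom fscale fscale \<pi>
    by unfold_locales
      (simp_all add: fscale_def fun_eq_iff \<pi>_def sum_distrib_left algebra_simps sum.distrib)

  have \<pi>_dep: "\<pi> d \<in> dependencies Z R (\<lambda>X. \<alpha> (r X))" if d: "d \<in> dependencies V A \<alpha>" for d
  proof -
    have "(\<Sum>X\<in>R. \<pi> d X * \<alpha> (r X) v) = 0" if v: "v \<in> Z" for v
    proof -
      have "(\<Sum>X\<in>R. \<pi> d X * \<alpha> (r X) v) = (\<Sum>X\<in>R. \<Sum>H | H \<in> A - L \<and> Z \<inter> H = X. d H * \<alpha> H v)"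
      proof (rule sum.cong[OF refl])
        fix X assume X: "X \<in> R"
        have "t H * d H * \<alpha> (r X) v = d H * \<alpha> H v" if "H \<in> {H \<in> A - L. Z \<inter> H = X}" for H
        proof -
          have "\<alpha> H v = t H * \<alpha> (r X) v" using t v that by blast
          then show ?thesis by (simp only: ac_simps)
        qed
        then show "\<pi> d X * \<alpha> (r X) v = (\<Sum>H | H \<in> A - L \<and> Z \<inter> H = X. d H * \<alpha> H v)"
          unfolding \<pi>_def if_P[OF X] sum_distrib_right by (rule sum.cong[OF refl])
      qed
      \<comment> \<open>The families of hyperplanes with a common trace partition
        \<open>A - L\<close>.\<close>
      also have "\<dots> = (\<Sum>H\<in>A - L. d H * \<alpha> H v)"
        using fin finR R by (intro sum.group) auto
      \<comment> \<open>The forms of hyperplanes in \<open>L\<close> vanish on \<open>Z\<close>, so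
        their terms can be added back.\<close>
      also have "\<dots> = (\<Sum>H\<in>A. d H * \<alpha> H v)"
        using fin v ZV ker LA by (intro sum.mono_neutral_left) (auto simp: L_def localization_def)
      also have "\<dots> = 0" using d v ZV unfolding dependencies_def by blast
      finally show ?thesis .
    qed
    then show ?thesis by (simp add: dependencies_def \<pi>_def)
  qed

  \<comment> \<open>A nonzero coordinate at \<open>X\<close> requires some \<open>H\<close> with
    trace \<open>X\<close> and \<open>d H\<close> nonzero, so the support of \<open>\<pi> d\<close>
    lies in the image of the support of \<open>d\<close>.\<close>
  have \<pi>_len: "dep_length R (\<pi> d) \<le> dep_length A d" for d
  proof -
    have "{X \<in> R. \<pi> d X \<noteq> 0} \<subseteq> (\<inter>) Z ` {H \<in> A. d H \<noteq> 0}"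
    proof
      fix X assume "X \<in> {X \<in> R. \<pi> d X \<noteq> 0}"
      then have "(\<Sum>H | H \<in> A - L \<and> Z \<inter> H = X. t H * d H) \<noteq> 0" by (simp add: \<pi>_def split: if_splits)
      then obtain H where "H \<in> A - L" "Z \<inter> H = X" "t H * d H \<noteq> 0"
        by (elim sum.not_neutral_contains_not_neutral) auto
      then show "X \<in> (\<inter>) Z ` {H \<in> A. d H \<noteq> 0}" by auto
    qed
    then show ?thesis unfolding dep_length_def using fin by (intro surj_card_le) auto
  qed

  have \<pi>_surj: "c \<in> \<pi> ` dependencies V A \<alpha>" if c: "c \<in> dependencies Z R (\<lambda>X. \<alpha> (r X))" for c
  proof -
    define f where "f v = (\<Sum>X\<in>R. c X * \<alpha> (r X) v)" for v
    have "\<exists>e. \<forall>v\<in>V. f v = (\<Sum>H\<in>L. e H * \<alpha> H v)"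
    proof (rule form_vanishing_on_common_kernel[OF finL V])
      show "linear_form_on scale V (\<alpha> H)" if "H \<in> L" for H using lin that LA by blast
      show "linear_form_on scale V f"
        unfolding f_def using lin rX by (intro linear_form_on_sum) auto
      fix v assume v: "v \<in> V" "\<And>H. H \<in> L \<Longrightarrow> \<alpha> H v = 0"
      \<comment> \<open>The hyperplanes cutting out \<open>Z\<close> all contain \<open>Z\<close>,
        hence lie in \<open>L\<close>. A common zero of the forms of \<open>L\<close> is therefore
        in \<open>Z\<close>, where \<open>f\<close> vanishes because \<open>c\<close> is a
        dependency.\<close>
      obtain C where C: "C \<subseteq> A" "Z = V \<inter> \<Inter>C"
        using Z(1) unfolding intersections_def by blast
      then have "C \<subseteq> L" unfolding L_def localization_def by blast
      then have "v \<in> Z" using v ker C LA by blast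
      then show "f v = 0" using c unfolding dependencies_def f_def by blast
    qed
    then obtain e where e: "\<forall>v\<in>V. f v = (\<Sum>H\<in>L. e H * \<alpha> H v)" by blast
    \<comment> \<open>The lift of \<open>c\<close>: its values sit on the chosen representatives,
      recognised by \<open>H = r (Z \<inter> H)\<close>, and contribute \<open>f\<close>. The
      coefficients \<open>- e H\<close> on \<open>L\<close> cancel \<open>f\<close> on all of
      \<open>V\<close>.\<close>
    define d where "d H = (if H \<in> L then - e H else if H \<in> A \<and> H = r (Z \<inter> H) then c (Z \<inter> H) else 0)"
      for H
    have dr: "d (r X) = c X" if "X \<in> R" for X using rX[OF that] by (simp add: d_def)
    have injr: "inj_on r R" using rX(3) by (metis inj_onI)
    have rR: "r ` R \<subseteq> A - L" using rX by blast
    have "(\<Sum>H\<in>A. d H * \<alpha> H v) = 0" if v: "v \<in> V" for v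
    proof -
      have "(\<Sum>H\<in>A - L. d H * \<alpha> H v) = (\<Sum>H\<in>r ` R. d H * \<alpha> H v)"
      proof (rule sum.mono_neutral_right)
        show "\<forall>H\<in>A - L - r ` R. d H * \<alpha> H v = 0"
        proof
          fix H assume H: "H \<in> A - L - r ` R"
          then have "H \<noteq> r (Z \<inter> H)" using ZH by blast
          then show "d H * \<alpha> H v = 0" using H by (auto simp: d_def)
        qed
      qed (use fin rR in auto)
      also have "\<dots> = f v"
        unfolding f_def by (simp add: sum.reindex[OF injr] dr)
      finally have "(\<Sum>H\<in>A - L. d H * \<alpha> H v) = f v" .
      moreover have "(\<Sum>H\<in>L. d H * \<alpha> H v) = - f v"
        using e v by (simp add: d_def sum_negf)
      ultimately show ?thesis using sum.subset_diff[OF LA fin, of "\<lambda>H. d H * \<alpha> H v"] by simp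
    qed
    then have "d \<in> dependencies V A \<alpha>" using LA by (auto simp: dependencies_def d_def)
    \<comment> \<open>Among the hyperplanes outside \<open>L\<close> with trace \<open>X\<close>,
      only \<open>r X\<close> can carry a nonzero coefficient, and its factor is 1. The coefficients
      on \<open>L\<close> are discarded by \<pi>.\<close>
    moreover have "\<pi> d X = c X" for X
    proof (cases "X \<in> R")
      case True
      have "(\<Sum>H | H \<in> A - L \<and> Z \<inter> H = X. t H * d H) = (\<Sum>H\<in>{r X}. t H * d H)"
        by (rule sum.mono_neutral_right) (use fin rX[OF True] in \<open>auto simp: d_def\<close>)
      then show ?thesis using True tr dr by (simp add: \<pi>_def)
    next
      case False
      then show ?thesis using c by (simp add: \<pi>_def dependencies_def)
    qed
    ultimately show ?thesis by (intro image_eqI[of _ _ d]) auto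
  qed

  let ?D = "dependencies Z R (\<lambda>X. \<alpha> (r X))"
  have "fs.subspace ?D"
    by (rule fs.subspaceI)
      (simp_all add: dependencies_def fscale_def distrib_right sum.distrib mult.assoc
        flip: sum_distrib_left)
  then have "fs.span {c \<in> ?D. dep_length R c \<le> 3} \<subseteq> ?D" by (intro fs.span_minimal) auto
  moreover have "?D \<subseteq> fs.span {c \<in> ?D. dep_length R c \<le> 3}"
  proof -
    have "fs.span {d \<in> dependencies V A \<alpha>. dep_length A d \<le> 3} = dependencies V A \<alpha>"
      using gen unfolding spanned_by_short_def fscale_def .
    \<comment> \<open>Surjectivity writes each dependency of the restriction as an image of a
      combination of short ones. By linearity it is a combination of their images, which are again
      short dependencies.\<close>
    then have "?D \<subseteq> \<pi> ` fs.span {d \<in> dependencies V A \<alpha>. dep_length A d \<le> 3}"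
      using \<pi>_surj by auto
    also have "\<dots> = fs.span (\<pi> ` {d \<in> dependencies V A \<alpha>. dep_length A d \<le> 3})"
      by (rule p.span_image[symmetric])
    also have "\<dots> \<subseteq> fs.span {c \<in> ?D. dep_length R c \<le> 3}"
      using \<pi>_dep \<pi>_len by (intro fs.span_mono) (auto intro: order_trans)
    finally show ?thesis .
  qed
  ultimately show ?thesis
    unfolding spanned_by_short_def R_def[symmetric] fscale_def[symmetric] by blast
qed

end

section \<open>Heredity of formality\<close>

theorem theorem1p2:
  fixes scale :: "'k::field \<Rightarrow> 'v::ab_group_add \<Rightarrow> 'v"
    and V :: "'v set" and B :: "'v set" and A :: "'v set set"
  assumes "vector_space scale"
    and "finite B" and "V = module.span scale B"
    and "hyperplane_arrangement scale V A"
    and "formal scale V A"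
  shows "\<forall>Z \<in> intersections V A.
           hyperplane_arrangement scale Z (restriction A Z) \<and>
           formal scale Z (restriction A Z)"
proof
  interpret vector_space scale by fact
  fix Z assume Z: "Z \<in> intersections V A"
  have V: "subspace V" using assms(3) by simp
  have fin: "finite A" and sub: "\<And>H. H \<in> A \<Longrightarrow> subspace H"
    using assms(4) unfolding hyperplane_arrangement_def hyperplane_in_def by auto
  have ZV: "Z \<subseteq> V" using Z unfolding intersections_def by blast
  have sZ: "subspace Z"
    using Z V sub unfolding intersections_def by (auto intro!: subspace_inter subspace_Inter)
  obtain \<alpha> where \<alpha>: "defining_forms scale V A \<alpha>" and gen: "spanned_by_short V A \<alpha>"
    using assms(5) unfolding formal_def by blast
  have lin: "linear_form_on scale Z (\<alpha> H)" and ker: "{v \<in> Z. \<alpha> H v = 0} = Z \<inter> H" if "H \<in> A" for H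
  proof -
    have H: "linear_form_on scale V (\<alpha> H)" "{v \<in> V. \<alpha> H v = 0} = H"
      using \<alpha> that unfolding defining_forms_def by auto
    show "linear_form_on scale Z (\<alpha> H)" using linear_form_on_subset[OF H(1) ZV] .
    show "{v \<in> Z. \<alpha> H v = 0} = Z \<inter> H" by (subst (2) H(2)[symmetric]) (use ZV in auto)
  qed
  have "hyperplane_in scale Z X" if "X \<in> restriction A Z" for X
  proof -
    obtain H where H: "H \<in> A" "\<not> Z \<subseteq> H" "X = Z \<inter> H"
      using \<open>X \<in> restriction A Z\<close> unfolding restriction_def localization_def by blast
    \<comment> \<open>Since \<open>H\<close> does not contain \<open>Z\<close>, its form is nonzero
      on \<open>Z\<close>, so its kernel \<open>Z \<inter> H\<close> has codimension 1 in
      \<open>Z\<close>.\<close>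
    then obtain u where u: "u \<in> Z" "\<alpha> H u \<noteq> 0" using ker[OF H(1)] by blast
    show ?thesis
      using hyperplane_in_kernel[OF sZ assms(2) _ lin[OF H(1)] u] ZV assms(3) ker[OF H(1)] H(3)
      by simp
  qed
  moreover have "finite (restriction A Z)" using fin unfolding restriction_def by simp
  moreover have "formal scale Z (restriction A Z)"
  proof -
    \<comment> \<open>Any choice of representatives supplies defining forms for the restriction, and
      \<open>formal\<close> asks for just one such family.\<close>
    have "\<forall>X\<in>restriction A Z. \<exists>H. H \<in> A - localization A Z \<and> Z \<inter> H = X"
      unfolding restriction_def by blast
    then obtain r where
      r: "\<forall>X\<in>restriction A Z. r X \<in> A - localization A Z \<and> Z \<inter> r X = X"
      by (rule bchoice[THEN exE])
    have "defining_forms scale Z (restriction A Z) (\<lambda>X. \<alpha> (r X))"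
      using r lin ker unfolding defining_forms_def by auto
    moreover have "spanned_by_short Z (restriction A Z) (\<lambda>X. \<alpha> (r X))"
      using spanned_by_short_restriction[OF V fin \<alpha> gen Z sZ] r by blast
    ultimately show ?thesis unfolding formal_def by blast
  qed
  ultimately show "hyperplane_arrangement scale Z (restriction A Z) \<and>
      formal scale Z (restriction A Z)"
    unfolding hyperplane_arrangement_def by blast
qed

end
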